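(* Let $n\ge 2$ and let $\Sigma=L_1\cup\cdots\cup L_n\subset\mathbb{C}^2$ be a union of $n$ distinct complex lines. Suppose that $\Sigma$ has at least one singular point. Then the fundamental group $\pi_1(\mathbb{C}^2\setminus\Sigma)$ contains a subgroup $H$ which is isomorphic to a free abelian group of rank $2$.
   Context: A complex line in $\mathbb{C}^2$ is the solution set of a linear equation $ax+by+c=0$ with $a,b,c\in\mathbb{C}$ and $(a,b)\neq(0,0)$. A singular point of $\Sigma$ is a point lying on at least two of the distinct lines $L_1,\dots,L_n$. The fundamental group is that of the complement with its topology induced from $\mathbb{C}^2$ (the complement is path connected, so the base point is irrelevant). *)

theory Defs
  imports "HOL-Analysis.Analysis" "HOL-Algebra.Free_Abelian_Groups"
begin

definition complex_line :: "(complex \<times> complex) set \<Rightarrow> bool"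
  where "complex_line l \<longleftrightarrow>
    (\<exists>a b c. (a, b) \<noteq> (0, 0) \<and> l = {(x, y). a * x + b * y + c = 0})"

definition singular_point :: "(nat \<Rightarrow> (complex \<times> complex) set) \<Rightarrow> nat \<Rightarrow> complex \<times> complex \<Rightarrow> bool"
  where "singular_point L n p \<longleftrightarrow>
    (\<exists>i<n. \<exists>j<n. L i \<noteq> L j \<and> p \<in> L i \<and> p \<in> L j)"

definition loops_at :: "'a::topological_space set \<Rightarrow> 'a \<Rightarrow> (real \<Rightarrow> 'a) set"
  where "loops_at S z =
    {p. path p \<and> path_image p \<subseteq> S \<and> pathstart p = z \<and> pathfinish p = z}"

definition path_class :: "'a::topological_space set \<Rightarrow> (real \<Rightarrow> 'a) \<Rightarrow> (real \<Rightarrow> 'a) set"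
  where "path_class S p = {q. homotopic_paths S p q}"

text \<open>The fundamental group of the subspace \<open>S\<close> at \<open>z\<close>. The product of two classes
  is written as the saturation of the pointwise concatenation, so that no representatives
  have to be chosen; lemma \<open>fundamental_group_mult\<close> gives the usual description.\<close>

definition fundamental_group :: "'a::topological_space set \<Rightarrow> 'a \<Rightarrow> (real \<Rightarrow> 'a) set monoid"
  where "fundamental_group S z =
    \<lparr>carrier = path_class S ` loops_at S z,
     monoid.mult = (\<lambda>X Y. \<Union>p\<in>X. \<Union>q\<in>Y. path_class S (p +++ q)),
     one = path_class S (\<lambda>_. z)\<rparr>"

lemma path_class_eq:
  assumes "homotopic_paths S p q"
  shows "path_class S p = path_class S q"
  unfolding path_class_def
  by (rule Collect_cong) (metis assms homotopic_paths_trans homotopic_paths_sym)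

lemma loops_at_join:
  "p \<in> loops_at S z \<Longrightarrow> q \<in> loops_at S z \<Longrightarrow> p +++ q \<in> loops_at S z"
  by (auto simp: loops_at_def path_image_join)

lemma loops_at_const: "z \<in> S \<Longrightarrow> (\<lambda>_. z) \<in> loops_at S z"
  by (auto simp: loops_at_def path_def path_image_def pathstart_def pathfinish_def)

lemma fundamental_group_mult:
  assumes "p \<in> loops_at S z" "q \<in> loops_at S z"
  shows "path_class S p \<otimes>\<^bsub>fundamental_group S z\<^esub> path_class S q = path_class S (p +++ q)"
proof -
  have eq: "path_class S (p' +++ q') = path_class S (p +++ q)"
    if "p' \<in> path_class S p" "q' \<in> path_class S q" for p' q'
  proof -
    have "homotopic_paths S (p +++ q) (p' +++ q')"
      using that assms by (intro homotopic_paths_join) (simp_all add: path_class_def loops_at_def)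
    then show ?thesis
      by (rule path_class_eq[symmetric])
  qed
  have "p \<in> path_class S p" "q \<in> path_class S q"
    using assms by (simp_all add: path_class_def loops_at_def)
  then have "(\<Union>p'\<in>path_class S p. \<Union>q'\<in>path_class S q. path_class S (p' +++ q'))
      = path_class S (p +++ q)"
    using eq by blast
  then show ?thesis
    by (simp add: fundamental_group_def)
qed

lemma group_fundamental_group:
  fixes S :: "'a::real_normed_vector set"
  assumes "z \<in> S"
  shows "group (fundamental_group S z)" (is "group ?G")
proof -
  have car: "carrier ?G = path_class S ` loops_at S z"
    and one: "\<one>\<^bsub>?G\<^esub> = path_class S (linepath z z)"
    by (simp_all add: fundamental_group_def linepath_refl)
  have lp: "linepath z z \<in> loops_at S z"
    using assms by (simp add: loops_at_def)
  show ?thesis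
  proof (rule groupI)
    fix X Y assume "X \<in> carrier ?G" "Y \<in> carrier ?G"
    then show "X \<otimes>\<^bsub>?G\<^esub> Y \<in> carrier ?G"
      unfolding car by (auto simp: fundamental_group_mult loops_at_join)
  next
    show "\<one>\<^bsub>?G\<^esub> \<in> carrier ?G"
      unfolding car one using lp by blast
  next
    fix X Y Z assume "X \<in> carrier ?G" "Y \<in> carrier ?G" "Z \<in> carrier ?G"
    then obtain p q r where pqr: "p \<in> loops_at S z" "q \<in> loops_at S z" "r \<in> loops_at S z"
      and XYZ: "X = path_class S p" "Y = path_class S q" "Z = path_class S r"
      unfolding car by auto
    have "homotopic_paths S (p +++ (q +++ r)) ((p +++ q) +++ r)"
      using pqr by (intro homotopic_paths_assoc) (auto simp: loops_at_def)
    from path_class_eq[OF this] show "X \<otimes>\<^bsub>?G\<^esub> Y \<otimes>\<^bsub>?G\<^esub> Z = X \<otimes>\<^bsub>?G\<^esub> (Y \<otimes>\<^bsub>?G\<^esub> Z)"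
      using pqr by (simp add: XYZ fundamental_group_mult loops_at_join)
  next
    fix X assume "X \<in> carrier ?G"
    then obtain p where p: "p \<in> loops_at S z" and X: "X = path_class S p"
      unfolding car by auto
    have "homotopic_paths S (linepath z z +++ p) p"
      using p by (intro homotopic_paths_lid') (auto simp: loops_at_def)
    from path_class_eq[OF this] show "\<one>\<^bsub>?G\<^esub> \<otimes>\<^bsub>?G\<^esub> X = X"
      unfolding X one using p lp by (simp add: fundamental_group_mult)
    have r: "reversepath p \<in> loops_at S z"
      using p by (auto simp: loops_at_def)
    have "homotopic_paths S (reversepath p +++ p) (linepath z z)"
      using p homotopic_paths_linv[of p S] by (auto simp: loops_at_def)
    from path_class_eq[OF this] have "path_class S (reversepath p) \<otimes>\<^bsub>?G\<^esub> X = \<one>\<^bsub>?G\<^esub>"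
      unfolding X one using p r by (simp add: fundamental_group_mult)
    then show "\<exists>Y\<in>carrier ?G. Y \<otimes>\<^bsub>?G\<^esub> X = \<one>\<^bsub>?G\<^esub>"
      unfolding car using r by blast
  qed
qed

end

theory Submission
  imports Defs "HOL-Complex_Analysis.Winding_Numbers"
begin

text \<open>Let \<open>p\<close> lie on two distinct lines, with directions \<open>u\<close> and \<open>v\<close>. If \<open>s\<close> is small and \<open>t\<close> is
  much smaller than \<open>s\<close>, then the torus \<open>p + s \<alpha> u + t \<beta> v\<close> (\<open>\<bar>\<alpha>\<bar> = \<bar>\<beta>\<bar> = 1\<close>) avoids all the lines: those
  missing \<open>p\<close> because \<open>s\<close> and \<open>t\<close> are small, and those through \<open>p\<close> other than the first because \<open>t\<close> is small
  relative to \<open>s\<close>. Its two coordinate circles commute in the fundamental group, and the winding numbers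
  around the two given lines show that they generate a free abelian group of rank 2.\<close>

section \<open>Groups\<close>

lemma (in group) int_pow_commutes:
  assumes "x \<otimes> y = y \<otimes> x" "x \<in> carrier G" "y \<in> carrier G"
  shows "x [^] (k::int) \<otimes> y = y \<otimes> x [^] k"
proof (cases k rule: int_cases)
  case (nonneg n)
  then show ?thesis
    using assms by (simp add: int_pow_int group_commutes_pow)
next
  case (neg n)
  have "x [^] Suc n \<otimes> y = y \<otimes> x [^] Suc n"
    using assms by (intro group_commutes_pow)
  then have "inv (x [^] Suc n) \<otimes> y = y \<otimes> inv (x [^] Suc n)"
    using assms by (metis inv_closed inv_solve_left inv_solve_right m_assoc m_closed nat_pow_closed)
  moreover have "x [^] k = inv (x [^] Suc n)"
    using neg assms by (metis int_pow_int int_pow_neg)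
  ultimately show ?thesis
    by simp
qed

text \<open>Commutation makes the products of powers of \<open>a\<close> and \<open>b\<close> closed
  under multiplication and inverses. The homomorphisms \<open>f\<close> and \<open>g\<close> read
  off the two exponents of such a product, so distinct exponent pairs give distinct
  elements.\<close>

lemma (in group) commuting_pair_free_Abelian:
  assumes a: "a \<in> carrier G" and b: "b \<in> carrier G" and ab: "a \<otimes> b = b \<otimes> a"
    and f: "f \<in> hom G integer_group" "f a = 1" "f b = 0"
    and g: "g \<in> hom G integer_group" "g a = 0" "g b = 1"
  shows "\<exists>H. subgroup H G \<and> G\<lparr>carrier := H\<rparr> \<cong> free_Abelian_group {..<2::nat}"
proof -
  define w where "w m n = a [^] m \<otimes> b [^] n" for m n :: int
  define H where "H = range (\<lambda>(m, n). w m n)"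
  have w_H: "w m n \<in> H" for m n
    by (auto simp: H_def)
  \<comment> \<open>The generators of the target group are \<open>frag_of 0\<close> and
    \<open>frag_of 1\<close>. The map is written through \<open>f\<close> and \<open>g\<close>, so
    it is defined without first proving that exponents are unique.\<close>
  define \<phi> where "\<phi> x = frag_cmul (f x) (frag_of (0::nat)) + frag_cmul (g x) (frag_of 1)" for x
  have w_closed: "w m n \<in> carrier G" for m n
    using a b by (simp add: w_def)
  have comm: "b [^] n \<otimes> a [^] m = a [^] m \<otimes> b [^] n" for m n :: int
    using a b ab int_pow_commutes by (metis int_pow_closed)
  have w_mult: "w m n \<otimes> w m' n' = w (m + m') (n + n')" for m n m' n'
  proof -
    have "w m n \<otimes> w m' n' = a [^] m \<otimes> (b [^] n \<otimes> a [^] m') \<otimes> b [^] n'"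
      using a b by (simp add: w_def m_assoc)
    also have "\<dots> = w (m + m') (n + n')"
      using a b by (simp add: comm w_def m_assoc int_pow_mult)
    finally show ?thesis .
  qed
  have w_one: "w 0 0 = \<one>"
    by (simp add: w_def)
  have fw: "f (w m n) = m" and gw: "g (w m n) = n" for m n
    using f g a b hom_int_pow[OF f(1) _ is_group group_integer_group] hom_int_pow[OF g(1) _ is_group group_integer_group]
    by (simp_all add: w_def hom_mult)
  have "subgroup H G"
  proof (rule subgroupI)
    show "H \<subseteq> carrier G" "H \<noteq> {}"
      by (auto simp: H_def w_closed)
  next
    fix x assume "x \<in> H"
    then obtain m n where x: "x = w m n"
      by (auto simp: H_def)
    have "w (-m) (-n) \<otimes> x = \<one>"
      by (simp add: x w_mult w_one)
    then have "inv x = w (-m) (-n)"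
      by (intro inv_equality) (auto simp: x w_closed)
    then show "inv x \<in> H"
      by (simp add: w_H)
  next
    fix x y assume "x \<in> H" "y \<in> H"
    then obtain m n m' n' where "x = w m n" "y = w m' n'"
      by (auto simp: H_def)
    then show "x \<otimes> y \<in> H"
      by (simp add: w_mult w_H)
  qed
  moreover have "\<phi> \<in> iso (G\<lparr>carrier := H\<rparr>) (free_Abelian_group {..<2})"
    unfolding iso_iff
  proof (intro conjI)
    show "\<phi> \<in> hom (G\<lparr>carrier := H\<rparr>) (free_Abelian_group {..<2})"
    proof (rule homI)
      fix x assume "x \<in> carrier (G\<lparr>carrier := H\<rparr>)"
      show "\<phi> x \<in> carrier (free_Abelian_group {..<2})"
        unfolding \<phi>_def carrier_free_Abelian_group_iff
        by (rule order.trans[OF Poly_Mapping.keys_add]) auto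
    next
      fix x y assume "x \<in> carrier (G\<lparr>carrier := H\<rparr>)" "y \<in> carrier (G\<lparr>carrier := H\<rparr>)"
      then show "\<phi> (x \<otimes>\<^bsub>G\<lparr>carrier := H\<rparr>\<^esub> y) = \<phi> x \<otimes>\<^bsub>free_Abelian_group {..<2}\<^esub> \<phi> y"
        by (auto simp: H_def w_mult \<phi>_def fw gw frag_cmul_distrib)
    qed
    have lookup: "Poly_Mapping.lookup (\<phi> (w m n)) k = (if k = 0 then m else if k = 1 then n else 0)" for m n k
      by (simp add: \<phi>_def fw gw lookup_add lookup_one when_def)
    show "\<phi> ` carrier (G\<lparr>carrier := H\<rparr>) = carrier (free_Abelian_group {..<2})"
    proof
      show "\<phi> ` carrier (G\<lparr>carrier := H\<rparr>) \<subseteq> carrier (free_Abelian_group {..<2})"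
        using \<open>\<phi> \<in> hom _ _\<close> by (auto simp: hom_def Pi_iff)
      show "carrier (free_Abelian_group {..<2}) \<subseteq> \<phi> ` carrier (G\<lparr>carrier := H\<rparr>)"
      proof
        fix c :: "nat \<Rightarrow>\<^sub>0 int" assume c: "c \<in> carrier (free_Abelian_group {..<2})"
        \<comment> \<open>The coefficients of \<open>c\<close> at the two generators serve as
          exponents. All keys of \<open>c\<close> lie below 2, so both sides vanish at every other
          index.\<close>
        have "c = \<phi> (w (Poly_Mapping.lookup c 0) (Poly_Mapping.lookup c 1))"
        proof (rule poly_mapping_eqI)
          fix k
          have "Poly_Mapping.lookup c k = 0" if "k \<ge> 2"
            using c that by (auto simp: in_keys_iff)
          then show "Poly_Mapping.lookup c k
              = Poly_Mapping.lookup (\<phi> (w (Poly_Mapping.lookup c 0) (Poly_Mapping.lookup c 1))) k"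
            unfolding lookup by (cases "k = 0"; cases "k = 1") auto
        qed
        then show "c \<in> \<phi> ` carrier (G\<lparr>carrier := H\<rparr>)"
          by (auto simp: H_def)
      qed
    qed
    show "inj_on \<phi> (carrier (G\<lparr>carrier := H\<rparr>))"
    proof (rule inj_onI)
      fix x y assume "x \<in> carrier (G\<lparr>carrier := H\<rparr>)" "y \<in> carrier (G\<lparr>carrier := H\<rparr>)" and eq: "\<phi> x = \<phi> y"
      then obtain m n m' n' where xy: "x = w m n" "y = w m' n'"
        by (auto simp: H_def)
      have "m = m'" "n = n'"
        using arg_cong[OF eq, of "\<lambda>c. Poly_Mapping.lookup c 0"] arg_cong[OF eq, of "\<lambda>c. Poly_Mapping.lookup c 1"]
        unfolding xy lookup by auto
      then show "x = y"
        by (simp add: xy)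
    qed
  qed
  ultimately show ?thesis
    by (meson is_isoI)
qed

section \<open>Loops\<close>

lemma carrier_fundamental_group: "carrier (fundamental_group S z) = path_class S ` loops_at S z"
  by (simp add: fundamental_group_def)

lemma path_class_refl: "p \<in> loops_at S z \<Longrightarrow> p \<in> path_class S p"
  by (simp add: path_class_def loops_at_def)

lemma loops_at_conjugate:
  assumes "path g" "path_image g \<subseteq> S" "p \<in> loops_at S (pathfinish g)"
  shows "g +++ p +++ reversepath g \<in> loops_at S (pathstart g)"
  using assms by (auto simp: loops_at_def path_image_join)

text \<open>This is the multiplicativity of a change of base point along \<open>g\<close>. In the
  middle of the product, \<open>reversepath g +++ g\<close> contracts to a constant path; the rest
  is reassociation.\<close>

lemma homotopic_conjugate_join:
  fixes g :: "real \<Rightarrow> 'a::real_normed_vector"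
  assumes g: "path g" "path_image g \<subseteq> S"
    and p: "p \<in> loops_at S (pathfinish g)" and q: "q \<in> loops_at S (pathfinish g)"
  shows "homotopic_paths S ((g +++ p +++ reversepath g) +++ (g +++ q +++ reversepath g))
           (g +++ (p +++ q) +++ reversepath g)"
proof -
  let ?r = "reversepath g" and ?q = "q +++ reversepath g"
  have P: "path p" "path_image p \<subseteq> S" "pathstart p = pathfinish g" "pathfinish p = pathfinish g"
    and Q: "path q" "path_image q \<subseteq> S" "pathstart q = pathfinish g" "pathfinish q = pathfinish g"
    using p q by (auto simp: loops_at_def)
  note facts = g P Q
  have "homotopic_paths S (?r +++ g +++ ?q) ((?r +++ g) +++ ?q)"
    using facts by (intro homotopic_paths_assoc) (auto simp: path_image_join)
  also have "homotopic_paths S \<dots> (linepath (pathfinish g) (pathfinish g) +++ ?q)"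
    using facts by (intro homotopic_paths_join homotopic_paths_linv homotopic_paths_refl[THEN iffD2]) (auto simp: path_image_join)
  also have "homotopic_paths S \<dots> ?q"
    using facts by (intro homotopic_paths_lid') (auto simp: path_image_join)
  finally have cancel: "homotopic_paths S (?r +++ g +++ ?q) ?q" .
  have "homotopic_paths S ((g +++ p +++ ?r) +++ (g +++ ?q)) (g +++ (p +++ ?r) +++ (g +++ ?q))"
    using facts by (intro homotopic_paths_sym[OF homotopic_paths_assoc]) (auto simp: path_image_join)
  also have "homotopic_paths S \<dots> (g +++ p +++ (?r +++ g +++ ?q))"
    using facts
    by (intro homotopic_paths_join homotopic_paths_refl[THEN iffD2] homotopic_paths_sym[OF homotopic_paths_assoc]) (auto simp: path_image_join)
  also have "homotopic_paths S \<dots> (g +++ p +++ ?q)"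
    using facts by (intro homotopic_paths_join homotopic_paths_refl[THEN iffD2] cancel) (auto simp: path_image_join)
  also have "homotopic_paths S \<dots> (g +++ (p +++ q) +++ ?r)"
    using facts by (intro homotopic_paths_join homotopic_paths_refl[THEN iffD2] homotopic_paths_assoc) (auto simp: path_image_join)
  finally show ?thesis .
qed

lemma homotopic_conjugates_commute:
  fixes g :: "real \<Rightarrow> 'a::real_normed_vector"
  assumes g: "path g" "path_image g \<subseteq> S"
    and p: "p \<in> loops_at S (pathfinish g)" and q: "q \<in> loops_at S (pathfinish g)"
    and pq: "homotopic_paths S (p +++ q) (q +++ p)"
  shows "homotopic_paths S ((g +++ p +++ reversepath g) +++ (g +++ q +++ reversepath g))
           ((g +++ q +++ reversepath g) +++ (g +++ p +++ reversepath g))"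
proof -
  have "homotopic_paths S (g +++ (p +++ q) +++ reversepath g) (g +++ (q +++ p) +++ reversepath g)"
    using g p q by (intro homotopic_paths_join[OF _ homotopic_paths_join[OF pq]] homotopic_paths_refl[THEN iffD2]) (auto simp: loops_at_def)
  then show ?thesis
    using homotopic_conjugate_join[OF g p q] homotopic_conjugate_join[OF g q p]
    by (meson homotopic_paths_sym homotopic_paths_trans)
qed

text \<open>Both concatenations are images of boundary paths of the unit square from (0, 0) to (1,
  1), one for each way round. These paths are homotopic in the plane, which maps continuously into
  the image of the torus.\<close>

lemma homotopic_torus_loops_commute:
  fixes F :: "complex \<times> complex \<Rightarrow> 'a::topological_space"
  assumes F: "continuous_on UNIV F" and S: "F ` (sphere 0 s \<times> sphere 0 t) \<subseteq> S" and st: "s \<ge> 0" "t \<ge> 0"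
  defines "a \<equiv> \<lambda>x. F (circlepath 0 s x, t)" and "b \<equiv> \<lambda>x. F (s, circlepath 0 t x)"
  shows "a \<in> loops_at S (F (s, t))" "b \<in> loops_at S (F (s, t))"
    "homotopic_paths S (a +++ b) (b +++ a)"
proof -
  \<comment> \<open>\<open>circlepath\<close> is an exponential formula valid for all real
    arguments, so \<open>h\<close> wraps the whole plane around the torus.\<close>
  define h where "h = (\<lambda>(x, y). F (circlepath 0 s x, circlepath 0 t y))"
  have h: "continuous_on UNIV h"
    unfolding h_def circlepath case_prod_unfold
    by (intro continuous_on_compose2[OF F] continuous_intros) auto
  have hS: "h x \<in> S" for x
    using S st by (force simp: h_def circlepath norm_mult split: prod.splits)
  \<comment> \<open>By periodicity, opposite edges of the unit square have the same image
    loop.\<close>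
  have a: "a = h \<circ> linepath (0, 0) (1, 0)" "a = h \<circ> linepath (0, 1) (1, 1)"
    and b: "b = h \<circ> linepath (0, 0) (0, 1)" "b = h \<circ> linepath (1, 0) (1, 1)"
    by (auto simp: a_def b_def h_def circlepath linepath_def fun_eq_iff)
  have "path (h \<circ> linepath x y)" for x y
    by (intro path_continuous_image path_linepath continuous_on_subset[OF h]) auto
  then have "path a" "path b"
    unfolding a(1) b(1) by auto
  moreover have "path_image a \<subseteq> S" "path_image b \<subseteq> S"
    unfolding a(1) b(1) path_image_def by (simp_all add: image_subset_iff hS)
  ultimately show "a \<in> loops_at S (F (s, t))" "b \<in> loops_at S (F (s, t))"
    by (auto simp: loops_at_def a_def b_def pathstart_def pathfinish_def circlepath)
  have "simply_connected (UNIV :: (real \<times> real) set)"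
    by (intro convex_imp_simply_connected) auto
  then have "homotopic_paths (UNIV :: (real \<times> real) set)
      (linepath (0, 0) (1, 0) +++ linepath (1, 0) (1, 1)) (linepath (0, 0) (0, 1) +++ linepath (0, 1) (1, 1))"
    unfolding simply_connected_eq_homotopic_paths by simp
  then have "homotopic_paths S (h \<circ> (linepath (0, 0) (1, 0) +++ linepath (1, 0) (1, 1)))
      (h \<circ> (linepath (0, 0) (0, 1) +++ linepath (0, 1) (1, 1)))"
    using h by (rule homotopic_paths_continuous_image) (use hS in auto)
  then show "homotopic_paths S (a +++ b) (b +++ a)"
    unfolding path_compose_join a(1)[symmetric] a(2)[symmetric] b(1)[symmetric] b(2)[symmetric] .
qed

section \<open>Winding numbers\<close>

text \<open>A class is a set of paths, so a representative is chosen; the floor of the real part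
  only converts an integral complex number to type \<open>int\<close>, as
  \<open>integer_group\<close> requires. Both choices are harmless for classes of loops in a set on
  which \<open>f\<close> is continuous and nowhere zero.\<close>

definition winding_around_zero ::
    "('a::topological_space \<Rightarrow> complex) \<Rightarrow> (real \<Rightarrow> 'a) set \<Rightarrow> int"
  where "winding_around_zero f X = \<lfloor>Re (winding_number (f \<circ> (SOME p. p \<in> X)) 0)\<rfloor>"

context
  fixes f :: "'a::topological_space \<Rightarrow> complex" and S :: "'a set"
  assumes cont: "continuous_on S f" and nz: "0 \<notin> f ` S"
begin

lemma path_image_zero:
  assumes "path p" "path_image p \<subseteq> S"
  shows "path (f \<circ> p)" "0 \<notin> path_image (f \<circ> p)"
  using assms nz cont
  by (auto simp: path_image_compose intro!: path_continuous_image intro: continuous_on_subset)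

text \<open>Composition with \<open>f\<close> carries a homotopy in \<open>S\<close> into the
  punctured plane, where the winding number is invariant. It is an integer because the composed path
  is closed.\<close>

lemma winding_around_zero_path_class:
  assumes "p \<in> loops_at S z"
  shows "of_int (winding_around_zero f (path_class S p)) = winding_number (f \<circ> p) 0"
proof -
  define q where "q = (SOME q. q \<in> path_class S p)"
  have "q \<in> path_class S p"
    unfolding q_def using path_class_refl[OF assms] by (rule someI[of "\<lambda>q. q \<in> path_class S p"])
  then have "homotopic_paths S p q"
    by (simp add: path_class_def)
  then have "homotopic_paths (-{0}) (f \<circ> p) (f \<circ> q)"
    using cont by (rule homotopic_paths_continuous_image) (use nz in auto)
  then have eq: "winding_number (f \<circ> p) 0 = winding_number (f \<circ> q) 0"
    by (rule winding_number_homotopic_paths)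
  have "winding_number (f \<circ> p) 0 \<in> \<int>"
    using assms path_image_zero[of p]
    by (intro integer_winding_number) (auto simp: loops_at_def pathfinish_compose pathstart_compose)
  then obtain k where "winding_number (f \<circ> p) 0 = of_int k"
    by (auto elim: Ints_cases)
  then show ?thesis
    unfolding winding_around_zero_def q_def[symmetric] eq[symmetric] by simp
qed

text \<open>Winding numbers add under concatenation.\<close>

lemma winding_around_zero_hom: "winding_around_zero f \<in> hom (fundamental_group S z) integer_group"
proof (rule homI)
  fix X Y assume "X \<in> carrier (fundamental_group S z)" "Y \<in> carrier (fundamental_group S z)"
  then obtain p q where pq: "p \<in> loops_at S z" "q \<in> loops_at S z" and XY: "X = path_class S p" "Y = path_class S q"
    by (auto simp: carrier_fundamental_group)
  have "winding_number (f \<circ> (p +++ q)) 0 = winding_number (f \<circ> p) 0 + winding_number (f \<circ> q) 0"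
    unfolding path_compose_join using pq path_image_zero
    by (intro winding_number_join) (auto simp: loops_at_def pathfinish_compose pathstart_compose)
  then have "complex_of_int (winding_around_zero f (path_class S (p +++ q)))
      = of_int (winding_around_zero f X + winding_around_zero f Y)"
    using pq by (simp add: XY winding_around_zero_path_class loops_at_join[of _ _ z] winding_around_zero_path_class[OF loops_at_join[OF pq]])
  then show "winding_around_zero f (X \<otimes>\<^bsub>fundamental_group S z\<^esub> Y)
      = winding_around_zero f X \<otimes>\<^bsub>integer_group\<^esub> winding_around_zero f Y"
    using pq by (simp only: of_int_eq_iff XY fundamental_group_mult mult_integer_group)
qed auto

text \<open>The contributions of \<open>g\<close> and of its reversal cancel. Hence winding numbers
  can be computed on the torus itself, whatever the path from the base point to it.\<close>

lemma winding_around_zero_conjugate: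
  assumes g: "path g" "path_image g \<subseteq> S" and p: "p \<in> loops_at S (pathfinish g)"
  shows "of_int (winding_around_zero f (path_class S (g +++ p +++ reversepath g))) = winding_number (f \<circ> p) 0"
proof -
  have P: "path p" "path_image p \<subseteq> S" "pathstart p = pathfinish g" "pathfinish p = pathfinish g"
    using p by (auto simp: loops_at_def)
  have "winding_number (f \<circ> (g +++ p +++ reversepath g)) 0 = winding_number (f \<circ> g) 0
      + (winding_number (f \<circ> p) 0 + winding_number (reversepath (f \<circ> g)) 0)"
    unfolding path_compose_join path_compose_reversepath
    using path_image_zero[OF g] path_image_zero[OF P(1,2)] P(3,4)
    by (simp add: winding_number_join pathstart_compose pathfinish_compose not_in_path_image_join)
  also have "\<dots> = winding_number (f \<circ> p) 0"
    using path_image_zero[OF g] by (simp add: winding_number_reversepath)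
  finally show ?thesis
    using winding_around_zero_path_class[OF loops_at_conjugate[OF g p]] by simp
qed

end

section \<open>Line arrangements\<close>

text \<open>The affine map \<open>h\<close> sends the complex plane to the complex line through
  \<open>z\<close> and \<open>w\<close>. Each \<open>L k\<close> excludes at most one parameter,
  because its equation along \<open>h\<close> is affine and nonzero at 0. The plane minus finitely
  many points is path connected, and a path in it from 0 to 1 is mapped by \<open>h\<close> to the
  required one.\<close>

lemma path_component_complement_lines:
  assumes "finite K" "\<And>k. k \<in> K \<Longrightarrow> complex_line (L k)"
    and z: "z \<in> - (\<Union>k\<in>K. L k)" and w: "w \<in> - (\<Union>k\<in>K. L k)"
  shows "path_component (- (\<Union>k\<in>K. L k)) z w"
proof -
  define h where "h \<mu> = (fst z + \<mu> * (fst w - fst z), snd z + \<mu> * (snd w - snd z))" for \<mu>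
  have h01: "h 0 = z" "h 1 = w"
    by (simp_all add: h_def)
  have "finite {\<mu>. h \<mu> \<in> L k}" if "k \<in> K" for k
  proof -
    obtain a b c where L: "L k = {(x, y). a * x + b * y + c = 0}"
      using assms(2)[OF \<open>k \<in> K\<close>] unfolding complex_line_def by blast
    define d e where "d = a * fst z + b * snd z + c" and "e = a * (fst w - fst z) + b * (snd w - snd z)"
    have "d \<noteq> 0"
      using z that by (auto simp: d_def L case_prod_unfold)
    have "h \<mu> \<in> L k \<longleftrightarrow> d + \<mu> * e = 0" for \<mu>
      by (simp add: h_def L d_def e_def algebra_simps)
    \<comment> \<open>If \<open>e = 0\<close>, the left side is empty since \<open>d\<close> is
      nonzero, so the default value of the quotient does no harm.\<close>
    then have "{\<mu>. h \<mu> \<in> L k} \<subseteq> {- d / e}"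
      using \<open>d \<noteq> 0\<close> by (cases "e = 0") (auto simp: field_simps add_eq_0_iff)
    then show ?thesis
      using finite_subset by blast
  qed
  then have "finite (\<Union>k\<in>K. {\<mu>. h \<mu> \<in> L k})"
    using assms(1) by blast
  then have "path_connected (- (\<Union>k\<in>K. {\<mu>. h \<mu> \<in> L k}))"
    by (intro path_connected_complement_countable countable_finite) auto
  moreover have "0 \<in> - (\<Union>k\<in>K. {\<mu>. h \<mu> \<in> L k})" "1 \<in> - (\<Union>k\<in>K. {\<mu>. h \<mu> \<in> L k})"
    using z w by (auto simp: h01)
  ultimately obtain g where g: "path g" "path_image g \<subseteq> - (\<Union>k\<in>K. {\<mu>. h \<mu> \<in> L k})"
      "pathstart g = 0" "pathfinish g = 1"
    unfolding path_connected_def by metis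
  have "continuous_on UNIV h"
    unfolding h_def by (intro continuous_intros)
  then have "path (h \<circ> g)"
    using g(1) by (intro path_continuous_image) (auto intro: continuous_on_subset)
  moreover have "path_image (h \<circ> g) \<subseteq> - (\<Union>k\<in>K. L k)"
    using g(2) by (auto simp: path_image_compose)
  ultimately show ?thesis
    unfolding path_component_def
    using g(3,4) h01 by (metis pathfinish_compose pathstart_compose path_image_def)
qed

text \<open>The nested filters express that \<open>t\<close> is small depending on \<open>s\<close>.
  A nonzero \<open>C\<close> dominates when both radii are small; if \<open>C = 0\<close> and
  \<open>A\<close> is nonzero, \<open>A * x\<close> dominates once \<open>t\<close> is small
  relative to \<open>s\<close>; otherwise \<open>B * y\<close> is the only term and is
  nonzero.\<close>

lemma eventually_affine_nonzero_on_torus: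
  fixes A B C :: complex
  assumes "(A, B, C) \<noteq> (0, 0, 0)"
  shows "\<forall>\<^sub>F s in at_right 0. \<forall>\<^sub>F t in at_right 0.
           \<forall>(x, y) \<in> sphere 0 s \<times> sphere 0 t. A * x + B * y + C \<noteq> 0"
proof -
  have ev: "\<forall>\<^sub>F t in at_right 0. norm c * t < d" if "d > 0" for c :: complex and d :: real
  proof -
    have "((\<lambda>t. norm c * t) \<longlongrightarrow> norm c * 0) (at_right 0)"
      by (intro tendsto_intros)
    then show ?thesis
      using that by (auto dest: order_tendstoD)
  qed
  have pos: "\<forall>\<^sub>F t in at_right 0. (t::real) > 0"
    by (simp add: eventually_at_right_less)
  consider "C \<noteq> 0" | "C = 0" "A \<noteq> 0" | "C = 0" "A = 0" "B \<noteq> 0"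
    using assms by auto
  then show ?thesis
  proof cases
    case 1
    then have "norm C / 2 > 0"
      by simp
    show ?thesis
      using ev[OF \<open>norm C / 2 > 0\<close>, of A]
    proof eventually_elim
      case (elim s)
      show ?case
        using ev[OF \<open>norm C / 2 > 0\<close>, of B]
      proof eventually_elim
        case (elim t)
        have "A * x + B * y + C \<noteq> 0" if "norm x = s" "norm y = t" for x y
        proof
          assume "A * x + B * y + C = 0"
          then have "norm C = norm (A * x + B * y)"
            by (metis add_eq_0_iff norm_minus_cancel)
          also have "\<dots> \<le> norm A * s + norm B * t"
            using norm_triangle_ineq[of "A * x" "B * y"] that by (simp add: norm_mult)
          also have "\<dots> < norm C"
            using elim \<open>norm A * s < norm C / 2\<close> by simp
          finally show False
            by simp
        qed
        then show ?case
          by auto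
      qed
    qed
  next
    case 2
    show ?thesis
      using pos
    proof eventually_elim
      case (elim s)
      then have "norm A * s > 0"
        using 2 by simp
      show ?case
        using ev[OF \<open>norm A * s > 0\<close>, of B]
      proof eventually_elim
        case (elim t)
        have "A * x + B * y + C \<noteq> 0" if "norm x = s" "norm y = t" for x y
        proof
          assume "A * x + B * y + C = 0"
          then have "norm (A * x) = norm (B * y)"
            using 2 by (metis add.right_neutral add_eq_0_iff norm_minus_cancel)
          then show False
            using elim that by (simp add: norm_mult)
        qed
        then show ?case
          by auto
      qed
    qed
  next
    case 3
    then show ?thesis
      using pos by (auto elim!: eventually_mono)
  qed
qed

text \<open>The vanishing determinant makes the normals proportional, and the common point forces
  the same factor on the constants. Contrapositively, distinct lines through a common point have
  independent normals.\<close>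

lemma complex_line_eqI:
  fixes a b c a' b' c' :: complex
  assumes "(a, b) \<noteq> (0, 0)" "(a', b') \<noteq> (0, 0)" and det: "a * b' = b * a'"
    and p: "a * p + b * q + c = 0" "a' * p + b' * q + c' = 0"
  shows "{(x, y). a * x + b * y + c = 0} = {(x, y). a' * x + b' * y + c' = 0}"
proof -
  obtain k where k: "k \<noteq> 0" "a' = k * a" "b' = k * b"
  proof (cases "a = 0")
    case True
    with assms show ?thesis
      by (intro that[of "b' / b"]) auto
  next
    case False
    with assms show ?thesis
      by (intro that[of "a' / a"]) (auto simp: field_simps)
  qed
  have "a' * x + b' * y + c' = k * (a * x + b * y + c)" for x y
  proof -
    have "c' = k * c"
      using p unfolding k(2,3) by algebra
    then show ?thesis
      by (simp add: k(2,3) algebra_simps)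
  qed
  then show ?thesis
    using k(1) by simp
qed

theorem theorem2:
  fixes n :: nat
    and L :: "nat \<Rightarrow> (complex \<times> complex) set"
    and \<Sigma> :: "(complex \<times> complex) set"
    and z :: "complex \<times> complex"
  assumes "n \<ge> 2"
    and "\<And>i. i < n \<Longrightarrow> complex_line (L i)"
    and "inj_on L {..<n}"
    and "\<Sigma> = (\<Union>i<n. L i)"
    and "\<exists>p. singular_point L n p"
    and "z \<in> - \<Sigma>"
  shows "\<exists>H. subgroup H (fundamental_group (- \<Sigma>) z) \<and>
           (fundamental_group (- \<Sigma>) z)\<lparr>carrier := H\<rparr> \<cong> free_Abelian_group {..<2::nat}"
proof -
  obtain i j p q where ij: "i < n" "j < n" "L i \<noteq> L j" and p: "(p, q) \<in> L i" "(p, q) \<in> L j"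
    using assms(5) unfolding singular_point_def by fast
  have "\<forall>k. \<exists>a b c. k < n \<longrightarrow> (a, b) \<noteq> (0, 0) \<and> L k = {(x, y). a * x + b * y + c = 0}"
    using assms(2) by (simp add: complex_line_def)
  then obtain a b c where L: "\<And>k. k < n \<Longrightarrow> (a k, b k) \<noteq> (0, 0)"
      "\<And>k. k < n \<Longrightarrow> L k = {(x, y). a k * x + b k * y + c k = 0}"
    by metis
  define D where "D = a i * b j - b i * a j"
  have pi: "a i * p + b i * q + c i = 0" and pj: "a j * p + b j * q + c j = 0"
    using p ij by (auto simp: L)
  have D: "D \<noteq> 0"
    using complex_line_eqI[OF L(1)[OF ij(1)] L(1)[OF ij(2)] _ pi pj] ij by (auto simp: D_def L(2))
  \<comment> \<open>These are affine coordinates centred at the singular point: \<open>x\<close>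
    runs along the direction \<open>(b i, - a i)\<close> of \<open>L i\<close> and \<open>y\<close>
    along the direction \<open>(b j, - a j)\<close> of \<open>L j\<close>.\<close>
  define F where "F = (\<lambda>(x, y). (p + x * b i + y * b j, q - x * a i - y * a j))"
  define l where "l k = (\<lambda>v. a k * fst v + b k * snd v + c k)" for k
  have in_L: "v \<in> L k \<longleftrightarrow> l k v = 0" if "k < n" for k v
    by (simp add: L(2)[OF that] l_def case_prod_unfold)
  have lF: "l k (F (x, y)) = (a k * b i - b k * a i) * x + (a k * b j - b k * a j) * y + l k (p, q)" for k x y
    by (simp add: l_def F_def algebra_simps)
  \<comment> \<open>As there are finitely many lines, the quantifier over \<open>k\<close> moves
    outside both filters and each line is treated separately.\<close>
  have "\<forall>\<^sub>F s in at_right 0. \<forall>\<^sub>F t in at_right 0. \<forall>k\<in>{..<n}.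
      \<forall>(x, y) \<in> sphere 0 s \<times> sphere 0 t. l k (F (x, y)) \<noteq> 0"
  proof (unfold eventually_ball_finite_distrib[OF finite_lessThan], intro ballI)
    fix k assume "k \<in> {..<n}"
    then have k: "(a k, b k) \<noteq> (0, 0)"
      using L(1) by simp
    have "(a k * b i - b k * a i, a k * b j - b k * a j, l k (p, q)) \<noteq> (0, 0, 0)"
    proof
      assume "(a k * b i - b k * a i, a k * b j - b k * a j, l k (p, q)) = (0, 0, 0)"
      \<comment> \<open>The vanishing linear coefficients say that the normal of \<open>L k\<close>
        is proportional to those of \<open>L i\<close> and \<open>L j\<close>. These are
        independent, so it would be zero.\<close>
      then have "a k * D = 0" "b k * D = 0"
        unfolding D_def prod.inject by algebra+
      with D k show False
        by simp
    qed
    then show "\<forall>\<^sub>F s in at_right 0. \<forall>\<^sub>F t in at_right 0. \<forall>(x, y) \<in> sphere 0 s \<times> sphere 0 t. l k (F (x, y)) \<noteq> 0"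
      unfolding lF by (rule eventually_affine_nonzero_on_torus)
  qed
  then have "\<forall>\<^sub>F s in at_right 0. s > 0 \<and> (\<forall>\<^sub>F t in at_right 0. t > 0 \<and> (\<forall>k\<in>{..<n}.
      \<forall>(x, y) \<in> sphere 0 s \<times> sphere 0 t. l k (F (x, y)) \<noteq> 0))"
    by (simp add: eventually_conj_iff eventually_at_right_less)
  then obtain s where s: "s > 0" "\<forall>\<^sub>F t in at_right 0. t > 0 \<and> (\<forall>k\<in>{..<n}.
      \<forall>(x, y) \<in> sphere 0 s \<times> sphere 0 t. l k (F (x, y)) \<noteq> 0)"
    using eventually_happens'[OF trivial_limit_at_right_real] by blast
  then obtain t where t: "t > 0" and nz: "\<And>k x y. k < n \<Longrightarrow> norm x = s \<Longrightarrow> norm y = t \<Longrightarrow> l k (F (x, y)) \<noteq> 0"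
    using eventually_happens'[OF trivial_limit_at_right_real s(2)] by auto
  have F_image: "F ` (sphere 0 s \<times> sphere 0 t) \<subseteq> - \<Sigma>"
    using nz by (auto simp: assms(4) in_L)
  have contF: "continuous_on UNIV F"
    unfolding F_def case_prod_unfold by (intro continuous_intros)
  define \<alpha> \<beta> where "\<alpha> x = F (circlepath 0 s x, t)" and "\<beta> x = F (s, circlepath 0 t x)" for x
  have loops: "\<alpha> \<in> loops_at (- \<Sigma>) (F (s, t))" "\<beta> \<in> loops_at (- \<Sigma>) (F (s, t))"
      and comm: "homotopic_paths (- \<Sigma>) (\<alpha> +++ \<beta>) (\<beta> +++ \<alpha>)"
    using homotopic_torus_loops_commute[OF contF F_image] s(1) t
    unfolding \<alpha>_def[abs_def] \<beta>_def[abs_def] by auto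
  have "F (s, t) \<in> - \<Sigma>"
    using s(1) t by (intro subsetD[OF F_image] imageI) auto
  then have "path_component (- \<Sigma>) z (F (s, t))"
    using path_component_complement_lines[of "{..<n}" L z] assms(2,4,6) by simp
  then obtain g where g: "path g" "path_image g \<subseteq> - \<Sigma>" "pathstart g = z" "pathfinish g = F (s, t)"
    by (auto simp: path_component_def path_image_def)
  note loops = loops[folded g(4)]
  let ?G = "fundamental_group (- \<Sigma>) z"
  define A B where "A = path_class (- \<Sigma>) (g +++ \<alpha> +++ reversepath g)"
    and "B = path_class (- \<Sigma>) (g +++ \<beta> +++ reversepath g)"
  have conj: "g +++ \<alpha> +++ reversepath g \<in> loops_at (- \<Sigma>) z" "g +++ \<beta> +++ reversepath g \<in> loops_at (- \<Sigma>) z"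
    using loops_at_conjugate[OF g(1,2)] loops g(3) by auto
  have AB: "A \<in> carrier ?G" "B \<in> carrier ?G"
    using conj by (auto simp: A_def B_def carrier_fundamental_group)
  have AB_comm: "A \<otimes>\<^bsub>?G\<^esub> B = B \<otimes>\<^bsub>?G\<^esub> A"
    unfolding A_def B_def fundamental_group_mult[OF conj] fundamental_group_mult[OF conj(2,1)]
    by (intro path_class_eq homotopic_conjugates_commute[OF g(1,2)] loops comm)
  \<comment> \<open>The equations of the two lines are rescaled to invert \<open>F\<close>. Moving
    along \<open>L i\<close> leaves its own equation unchanged, so \<open>f\<^sub>i\<close> recovers
    \<open>y\<close> and \<open>f\<^sub>j\<close> recovers \<open>x\<close>; this explains the sign
    and the factor \<open>D\<close>.\<close>
  define f\<^sub>i f\<^sub>j where "f\<^sub>i v = l i v / D" and "f\<^sub>j v = - l j v / D" for v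
  have cont: "continuous_on (- \<Sigma>) f\<^sub>i" "continuous_on (- \<Sigma>) f\<^sub>j"
    unfolding f\<^sub>i_def f\<^sub>j_def l_def using D by (auto intro!: continuous_intros)
  have f_nz: "0 \<notin> f\<^sub>i ` (- \<Sigma>)" "0 \<notin> f\<^sub>j ` (- \<Sigma>)"
    using ij in_L D by (auto simp: f\<^sub>i_def f\<^sub>j_def assms(4))
  have fF: "f\<^sub>i (F (x, y)) = y" "f\<^sub>j (F (x, y)) = x" for x y
  proof -
    have "l i (F (x, y)) = D * y" "l j (F (x, y)) = - D * x"
      unfolding lF using pi pj by (simp_all add: l_def D_def algebra_simps)
    then show "f\<^sub>i (F (x, y)) = y" "f\<^sub>j (F (x, y)) = x"
      using D by (simp_all add: f\<^sub>i_def f\<^sub>j_def)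
  qed
  have "f\<^sub>i \<circ> \<alpha> = linepath t t" "f\<^sub>i \<circ> \<beta> = circlepath 0 t"
      "f\<^sub>j \<circ> \<alpha> = circlepath 0 s" "f\<^sub>j \<circ> \<beta> = linepath s s"
    by (auto simp: fF \<alpha>_def \<beta>_def linepath_refl)
  then have "winding_around_zero f\<^sub>i A = 0" "winding_around_zero f\<^sub>i B = 1"
      "winding_around_zero f\<^sub>j A = 1" "winding_around_zero f\<^sub>j B = 0"
    using winding_around_zero_conjugate[OF cont(1) f_nz(1) g(1,2)] winding_around_zero_conjugate[OF cont(2) f_nz(2) g(1,2)]
      loops s(1) t
    by (auto simp: A_def B_def winding_number_circlepath_centre winding_number_trivial[unfolded linepath_refl]
        simp flip: of_int_eq_iff[where 'a = complex])
  \<comment> \<open>The roles cross over: \<open>A\<close> comes from the circle in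
    \<open>x\<close>, which winds around \<open>L j\<close>, so the homomorphism of
    \<open>f\<^sub>j\<close> is supplied first.\<close>
  then show ?thesis
    using group.commuting_pair_free_Abelian[OF group_fundamental_group[OF assms(6)] AB AB_comm
        winding_around_zero_hom[OF cont(2) f_nz(2)] _ _ winding_around_zero_hom[OF cont(1) f_nz(1)]]
    by blast
qed

end
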